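(* Let $n\ge 2$, $m\ge 1$, $\varphi\in\Phi_m$, and let $\mu$ be a (nonnegative) Borel measure on $\left(\mathcal{K}^n_o\right)^m$ such that for each $x\in\mathbb{R}^n$ there is some $\lambda>0$ with $$\int_{(\mathcal{K}^n_o)^m}\varphi\left(\frac{h_{K_1}(x)}{\lambda},\dots,\frac{h_{K_m}(x)}{\lambda}\right)d\mu(K_1,\dots,K_m)<\infty.$$ Then the function $$x\mapsto\inf\left\{\lambda>0:\int_{(\mathcal{K}^n_o)^m}\varphi\left(\frac{h_{K_1}(x)}{\lambda},\dots,\frac{h_{K_m}(x)}{\lambda}\right)d\mu(K_1,\dots,K_m)\le 1\right\},\quad x\in\mathbb{R}^n,$$ is the support function of a compact convex set $C_{\varphi,\mu}$ in $\mathbb{R}^n$.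
   Context: $\mathcal{K}^n_o$ is the class of compact convex subsets of $\mathbb{R}^n$ containing the origin $o$, equipped with the Hausdorff metric (and $(\mathcal{K}^n_o)^m$ with the product topology). $h_K(x)=\sup\{x\cdot y:y\in K\}$ is the support function of $K$. $\Phi_m$ is the set of convex functions $\varphi:[0,\infty)^m\to[0,\infty)$ that are increasing (i.e. nondecreasing) in each variable and satisfy $\varphi(o)=0$ and $\varphi(e_j)=1$, $j=1,\dots,m$, where $e_1,\dots,e_m$ is the standard basis. *)

theory Defs
  imports "HOL-Analysis.Analysis"
begin

definition convex_bodies_o :: "'a::euclidean_space set set" where
  "convex_bodies_o = {K. compact K \<and> convex K \<and> 0 \<in> K}"

text \<open>Suprema below are real-valued, so they are meaningful only for nonempty compact sets. The value 0
  of \<open>hausdorff_dist\<close> on all other sets is a dummy, chosen because the locale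
  \<^locale>\<open>Metric_space\<close> requires nonnegativity and symmetry also outside the carrier.\<close>

definition support_fun :: "'a::euclidean_space set \<Rightarrow> 'a \<Rightarrow> real" where
  "support_fun K x = (SUP y\<in>K. x \<bullet> y)"

definition hausdorff_dist :: "'a::euclidean_space set \<Rightarrow> 'a set \<Rightarrow> real" where
  "hausdorff_dist K L =
    (if compact K \<and> K \<noteq> {} \<and> compact L \<and> L \<noteq> {}
     then max (SUP x\<in>K. infdist x L) (SUP y\<in>L. infdist y K) else 0)"

lemma bdd_above_infdist_compact:
  fixes K L :: "'a::euclidean_space set"
  assumes "compact K"
  shows "bdd_above ((\<lambda>x. infdist x L) ` K)"
  by (intro bounded_imp_bdd_above compact_imp_bounded compact_continuous_image assms
      continuous_intros)

lemma infdist_le_hausdorff_dist: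
  fixes K L :: "'a::euclidean_space set"
  assumes "compact K" "compact L" "L \<noteq> {}" "x \<in> K"
  shows "infdist x L \<le> hausdorff_dist K L" "infdist x L \<le> hausdorff_dist L K"
proof -
  have "infdist x L \<le> (SUP x\<in>K. infdist x L)"
    by (intro cSUP_upper assms bdd_above_infdist_compact)
  then show "infdist x L \<le> hausdorff_dist K L" "infdist x L \<le> hausdorff_dist L K"
    using assms by (auto simp: hausdorff_dist_def)
qed

lemma hausdorff_dist_le:
  fixes K L :: "'a::euclidean_space set"
  assumes "compact K" "K \<noteq> {}" "compact L" "L \<noteq> {}"
    and "\<And>x. x \<in> K \<Longrightarrow> infdist x L \<le> r" "\<And>y. y \<in> L \<Longrightarrow> infdist y K \<le> r"
  shows "hausdorff_dist K L \<le> r"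
  using assms by (auto simp: hausdorff_dist_def intro!: cSUP_least)

lemma hausdorff_dist_commute: "hausdorff_dist K L = hausdorff_dist L K"
  by (auto simp: hausdorff_dist_def max.commute)

lemma hausdorff_dist_nonneg: "0 \<le> hausdorff_dist K L"
proof (cases "compact K \<and> K \<noteq> {} \<and> compact L \<and> L \<noteq> {}")
  case True
  then obtain x where "x \<in> K" by auto
  with True show ?thesis
    using infdist_le_hausdorff_dist(1)[of K L x] infdist_nonneg[of x L] by linarith
qed (auto simp: hausdorff_dist_def)

lemma infdist_triangle_hausdorff:
  fixes K L M :: "'a::euclidean_space set"
  assumes "compact K" "compact L" "L \<noteq> {}" "compact M" "M \<noteq> {}" "x \<in> K"
  shows "infdist x M \<le> hausdorff_dist K L + hausdorff_dist L M"
proof -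
  obtain y where y: "y \<in> L" "infdist x L = dist x y"
    using infdist_attains_inf[of L x] assms compact_imp_closed by metis
  have "infdist x M \<le> infdist y M + dist x y"
    by (rule infdist_triangle)
  also have "\<dots> \<le> hausdorff_dist L M + hausdorff_dist K L"
    using infdist_le_hausdorff_dist(1)[of L M y] infdist_le_hausdorff_dist(1)[of K L x] assms y
    by simp
  finally show ?thesis by simp
qed

lemma Metric_space_hausdorff_dist:
  "Metric_space (convex_bodies_o :: 'a::euclidean_space set set) hausdorff_dist"
proof
  fix K L M :: "'a set"
  show "0 \<le> hausdorff_dist K L" by (rule hausdorff_dist_nonneg)
  show "hausdorff_dist K L = hausdorff_dist L K" by (rule hausdorff_dist_commute)
  assume "K \<in> convex_bodies_o" "L \<in> convex_bodies_o"
  then have KL: "compact K" "K \<noteq> {}" "compact L" "L \<noteq> {}"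
    by (auto simp: convex_bodies_o_def)
  show "hausdorff_dist K L = 0 \<longleftrightarrow> K = L"
  proof
    assume 0: "hausdorff_dist K L = 0"
    have "x \<in> L" if "x \<in> K" for x
      using infdist_le_hausdorff_dist(1)[of K L x] that KL 0 infdist_nonneg[of x L]
        in_closed_iff_infdist_zero[of L x] compact_imp_closed by auto
    moreover have "x \<in> K" if "x \<in> L" for x
      using infdist_le_hausdorff_dist(2)[of L K x] that KL 0 infdist_nonneg[of x K]
        in_closed_iff_infdist_zero[of K x] compact_imp_closed by auto
    ultimately show "K = L" by blast
  next
    assume "K = L"
    then have "hausdorff_dist K L \<le> 0" using KL by (intro hausdorff_dist_le) auto
    then show "hausdorff_dist K L = 0" using hausdorff_dist_nonneg[of K L] by linarith
  qed
  assume "M \<in> convex_bodies_o"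
  then have M: "compact M" "M \<noteq> {}" by (auto simp: convex_bodies_o_def)
  show "hausdorff_dist K M \<le> hausdorff_dist K L + hausdorff_dist L M"
  proof (rule hausdorff_dist_le)
    fix x assume "x \<in> K"
    then show "infdist x M \<le> hausdorff_dist K L + hausdorff_dist L M"
      using KL M by (intro infdist_triangle_hausdorff)
  next
    fix x assume "x \<in> M"
    then have "infdist x K \<le> hausdorff_dist M L + hausdorff_dist L K"
      using KL M by (intro infdist_triangle_hausdorff)
    then show "infdist x K \<le> hausdorff_dist K L + hausdorff_dist L M"
      by (simp add: hausdorff_dist_commute)
  qed (use KL M in auto)
qed

definition hausdorff_topology :: "'a::euclidean_space set topology" where
  "hausdorff_topology = Metric_space.mtopology convex_bodies_o hausdorff_dist"

lemma topspace_hausdorff_topology [simp]: "topspace hausdorff_topology = convex_bodies_o"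
  by (simp add: hausdorff_topology_def
      Metric_space.topspace_mtopology[OF Metric_space_hausdorff_dist])

text \<open>\<open>m\<close>-tuples of convex bodies are functions on a finite index type \<open>'m\<close> with \<open>m\<close> elements.\<close>

definition convex_bodies_tuple_topology :: "('m::finite \<Rightarrow> 'a::euclidean_space set) topology" where
  "convex_bodies_tuple_topology = product_topology (\<lambda>_. hausdorff_topology) UNIV"

definition borel_of_topology :: "'a topology \<Rightarrow> 'a measure" where
  "borel_of_topology X = sigma (topspace X) {U. openin X U}"

definition nonneg_orthant :: "(real ^ 'm) set" where
  "nonneg_orthant = {v. \<forall>j. 0 \<le> v $ j}"

text \<open>The class \<open>\<Phi>\<^sub>m\<close>; values of \<open>\<phi>\<close> outside the nonnegative orthant are irrelevant.\<close>

definition Phi_class :: "(real ^ 'm \<Rightarrow> real) set" where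
  "Phi_class = {\<phi>.
     (\<forall>v\<in>nonneg_orthant. 0 \<le> \<phi> v) \<and>
     convex_on nonneg_orthant \<phi> \<and>
     (\<forall>v\<in>nonneg_orthant. \<forall>j. \<forall>t \<ge> v $ j. \<phi> v \<le> \<phi> (\<chi> i. if i = j then t else v $ i)) \<and>
     \<phi> 0 = 0 \<and>
     (\<forall>j. \<phi> (axis j 1) = 1)}"

definition orlicz_integral ::
  "(real ^ 'm \<Rightarrow> real) \<Rightarrow> ('m::finite \<Rightarrow> 'a::euclidean_space set) measure \<Rightarrow> 'a \<Rightarrow> real \<Rightarrow> ennreal"
  where
  "orlicz_integral \<phi> \<mu> x s = (\<integral>\<^sup>+ K. ennreal (\<phi> (\<chi> j. support_fun (K j) x / s)) \<partial>\<mu>)"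

end

theory Submission
  imports Defs
begin

text \<open>Call \<open>s > 0\<close> admissible at \<open>x\<close> if the integral is at most 1. Admissible values
  scale with \<open>x\<close>, and if \<open>s\<close> is admissible at \<open>x\<close> and \<open>t\<close> at
  \<open>y\<close>, then \<open>s + t\<close> is admissible at \<open>x + y\<close>: the point \<open>h(x + y) / (s + t)\<close> is dominated by the convex
  combination of \<open>h(x) / s\<close> and \<open>h(y) / t\<close> with weights \<open>s / (s + t)\<close> and \<open>t / (s + t)\<close>. So the infimum is
  a sublinear function of \<open>x\<close>, and by separation of points from its epigraph, a finite sublinear
  function is the support function of the set of linear functionals that it dominates.\<close>

section \<open>Sublinear functions\<close>

text \<open>Homogeneity pulls the weights out of the two summands. Weights strictly between 0 and 1
  suffice, so only positive factors occur. In finite dimension, convexity then yields continuity of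
  \<open>f\<close>.\<close>

lemma sublinear_convex_on:
  fixes f :: "'a::real_vector \<Rightarrow> real"
  assumes hom: "\<And>c x. c > 0 \<Longrightarrow> f (c *\<^sub>R x) = c * f x"
    and sub: "\<And>x y. f (x + y) \<le> f x + f y"
  shows "convex_on UNIV f"
proof -
  have "f ((1 - t) *\<^sub>R x + t *\<^sub>R y) \<le> (1 - t) * f x + t * f y" if "0 < t" "t < 1" for t x y
    using sub[of "(1 - t) *\<^sub>R x" "t *\<^sub>R y"] that by (simp add: hom)
  then show ?thesis by (intro convex_onI) auto
qed

text \<open>The point \<open>(x, r)\<close> lies strictly below the epigraph of \<open>f\<close>, a
  closed convex cone, so a hyperplane separates them. The cone property lets it pass through the
  origin; it is not vertical, hence it is the graph of the desired functional.\<close>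

lemma ex_linear_minorant_sublinear:
  fixes f :: "'a::euclidean_space \<Rightarrow> real"
  assumes hom: "\<And>c x. c > 0 \<Longrightarrow> f (c *\<^sub>R x) = c * f x"
    and sub: "\<And>x y. f (x + y) \<le> f x + f y"
    and less: "r < f x"
  shows "\<exists>y. (\<forall>z. z \<bullet> y \<le> f z) \<and> r < x \<bullet> y"
proof -
  have conv: "convex_on UNIV f" using hom sub by (rule sublinear_convex_on)
  have cont: "continuous_on UNIV f" using conv by (intro convex_on_continuous) auto
  \<comment> \<open>Homogeneity is assumed for positive factors only, so the value at the origin is
    read off from \<open>f 0 = 2 * f 0\<close>.\<close>
  have f0: "f 0 = 0" using hom[of 2 0] by simp
  let ?E = "epigraph UNIV f"
  have "closed ?E"
  proof -
    have "continuous_on UNIV (\<lambda>p. f (fst p :: 'a) :: real)"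
      by (rule continuous_on_compose2[OF cont continuous_on_fst[OF continuous_on_id]]) simp
    then have "closed {p :: 'a \<times> real. f (fst p) \<le> snd p}"
      by (intro closed_Collect_le continuous_intros) auto
    then show ?thesis by (simp add: epigraph_def)
  qed
  moreover have "convex ?E" using conv by (rule convex_epigraphI)
  moreover have "(x, r) \<notin> ?E" using less by (simp add: mem_epigraph)
  ultimately obtain a \<beta> where ab: "a \<bullet> (x, r) < \<beta>" "\<And>w. w \<in> ?E \<Longrightarrow> \<beta> < a \<bullet> w"
    using separating_hyperplane_closed_point by metis
  obtain y b where a: "a = (y, b)" by (cases a)
  have sep: "\<beta> < y \<bullet> z + b * t" if "f z \<le> t" for z t
    using ab(2)[of "(z, t)"] that by (simp add: a mem_epigraph)
  have "\<beta> < 0" using sep[of 0 0] f0 by simp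
  have nonneg: "0 \<le> y \<bullet> z + b * f z" for z
  proof (rule ccontr)
    assume neg: "\<not> ?thesis"
    \<comment> \<open>Scaling \<open>(z, f z)\<close> by this \<open>c\<close> keeps it in the
      epigraph but puts it exactly on the level \<open>\<beta>\<close>.\<close>
    define c where "c = \<beta> / (y \<bullet> z + b * f z)"
    have "c > 0" using neg \<open>\<beta> < 0\<close> by (simp add: c_def divide_neg_neg)
    have "\<beta> < y \<bullet> (c *\<^sub>R z) + b * f (c *\<^sub>R z)" by (rule sep) simp
    also have "\<dots> = c * (y \<bullet> z + b * f z)" using \<open>c > 0\<close> by (simp add: hom algebra_simps)
    also have "\<dots> = \<beta>" using neg by (simp add: c_def)
    finally show False by simp
  qed
  have lt: "y \<bullet> x + b * r < 0" using ab(1) \<open>\<beta> < 0\<close> by (simp add: a)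
  \<comment> \<open>Comparing the points above \<open>x\<close> at the heights \<open>f x\<close>
    and \<open>r\<close> shows that the hyperplane is not vertical.\<close>
  then have "0 < b * (f x - r)" using nonneg[of x] by (simp add: algebra_simps)
  then have "b > 0" using less by (simp add: zero_less_mult_iff)
  \<comment> \<open>The witness comes from solving \<open>y \<bullet> z + b * t = 0\<close> for
    \<open>t\<close>.\<close>
  show ?thesis
  proof (intro exI conjI allI)
    fix z show "z \<bullet> (- (1 / b) *\<^sub>R y) \<le> f z"
      using nonneg[of z] \<open>b > 0\<close> by (simp add: field_simps inner_commute)
  next
    show "r < x \<bullet> (- (1 / b) *\<^sub>R y)"
      using lt \<open>b > 0\<close> by (simp add: field_simps inner_commute)
  qed
qed

text \<open>Take for \<open>C\<close> all linear functionals dominated by \<open>f\<close>. It is an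
  intersection of closed half-spaces, and testing on the basis vectors and their negatives bounds
  it. Minorants arbitrarily close to \<open>f x\<close> at \<open>x\<close> give the value of the
  supremum.\<close>

lemma sublinear_eq_support_fun:
  fixes f :: "'a::euclidean_space \<Rightarrow> real"
  assumes hom: "\<And>c x. c > 0 \<Longrightarrow> f (c *\<^sub>R x) = c * f x"
    and sub: "\<And>x y. f (x + y) \<le> f x + f y"
  obtains C where "compact C" "convex C" "C \<noteq> {}" "\<And>x. support_fun C x = f x"
proof
  let ?C = "{y. \<forall>z. z \<bullet> y \<le> f z}"
  have minor: "\<exists>y\<in>?C. r < x \<bullet> y" if "r < f x" for r x
    using ex_linear_minorant_sublinear[of f r x] hom sub that by blast
  have C: "?C = (\<Inter>z. {y. z \<bullet> y \<le> f z})" by auto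
  show "convex ?C" unfolding C by (intro convex_INT convex_halfspace_le)
  have "closed ?C" unfolding C by (intro closed_INT ballI closed_halfspace_le)
  moreover have "?C \<subseteq> cbox (\<Sum>b\<in>Basis. - f (- b) *\<^sub>R b) (\<Sum>b\<in>Basis. f b *\<^sub>R b)"
  proof
    fix y assume y: "y \<in> ?C"
    have "- f (- b) \<le> y \<bullet> b \<and> y \<bullet> b \<le> f b" for b
      using y[THEN CollectD, rule_format, of b] y[THEN CollectD, rule_format, of "- b"]
      by (simp add: inner_commute)
    then show "y \<in> cbox (\<Sum>b\<in>Basis. - f (- b) *\<^sub>R b) (\<Sum>b\<in>Basis. f b *\<^sub>R b)"
      by (auto simp: mem_box simp del: scaleR_minus_left)
  qed
  ultimately show "compact ?C"
    using bounded_subset[OF bounded_cbox] compact_eq_bounded_closed by blast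
  show "?C \<noteq> {}" using minor[of "f 0 - 1" 0] by auto
  then show "support_fun ?C x = f x" for x
    unfolding support_fun_def using minor[of _ x]
    by (intro cSup_eq_non_empty) (auto simp: not_less[symmetric])
qed

text \<open>One inequality, proved for all positive factors and all points, is enough: the other is
  its instance with factor \<open>1 / c\<close> at the scaled point.\<close>

lemma Inf_scaleR_eq:
  fixes S :: "'a::real_vector \<Rightarrow> real set"
  assumes ne: "\<And>x. S x \<noteq> {}" and nonneg: "\<And>x s. s \<in> S x \<Longrightarrow> 0 \<le> s"
    and scale: "\<And>c x s. c > 0 \<Longrightarrow> s \<in> S x \<Longrightarrow> c * s \<in> S (c *\<^sub>R x)"
    and "c > 0"
  shows "Inf (S (c *\<^sub>R x)) = c * Inf (S x)"
proof (rule antisym)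
  have bdd: "bdd_below (S x)" for x using nonneg by (rule bdd_belowI)
  have le: "Inf (S (c *\<^sub>R x)) \<le> c * Inf (S x)" if "c > 0" for c x
  proof -
    have "Inf (S (c *\<^sub>R x)) / c \<le> Inf (S x)"
    proof (rule cInf_greatest[OF ne])
      fix s assume "s \<in> S x"
      then have "Inf (S (c *\<^sub>R x)) \<le> c * s" using scale that bdd by (intro cInf_lower)
      then show "Inf (S (c *\<^sub>R x)) / c \<le> s" using that by (simp add: field_simps)
    qed
    then show ?thesis using that by (simp add: field_simps)
  qed
  show "Inf (S (c *\<^sub>R x)) \<le> c * Inf (S x)" using \<open>c > 0\<close> by (rule le)
  show "c * Inf (S x) \<le> Inf (S (c *\<^sub>R x))"
    using le[of "1 / c" "c *\<^sub>R x"] \<open>c > 0\<close> by (simp add: field_simps)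
qed

text \<open>The two infima are taken one after the other: over \<open>t\<close> with
  \<open>s\<close> fixed, then over \<open>s\<close>.\<close>

lemma Inf_add_le:
  fixes S :: "'a::ab_group_add \<Rightarrow> real set"
  assumes ne: "\<And>x. S x \<noteq> {}" and nonneg: "\<And>x s. s \<in> S x \<Longrightarrow> 0 \<le> s"
    and add: "\<And>s t. s \<in> S x \<Longrightarrow> t \<in> S y \<Longrightarrow> s + t \<in> S (x + y)"
  shows "Inf (S (x + y)) \<le> Inf (S x) + Inf (S y)"
proof -
  have "Inf (S (x + y)) - Inf (S y) \<le> Inf (S x)"
  proof (rule cInf_greatest[OF ne])
    fix s assume s: "s \<in> S x"
    have "Inf (S (x + y)) - s \<le> Inf (S y)"
    proof (rule cInf_greatest[OF ne])
      fix t assume "t \<in> S y"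
      then have "Inf (S (x + y)) \<le> s + t"
        using s add bdd_belowI[OF nonneg] by (intro cInf_lower)
      then show "Inf (S (x + y)) - s \<le> t" by simp
    qed
    then show "Inf (S (x + y)) - Inf (S y) \<le> s" by simp
  qed
  then show ?thesis by simp
qed

section \<open>Support functions\<close>

lemma inner_le_support_fun:
  assumes "compact K" "y \<in> K"
  shows "x \<bullet> y \<le> support_fun K x"
  unfolding support_fun_def using assms
  by (intro cSUP_upper bounded_imp_bdd_above compact_imp_bounded compact_continuous_image
      continuous_intros)

lemma support_fun_le:
  assumes "K \<noteq> {}" "\<And>y. y \<in> K \<Longrightarrow> x \<bullet> y \<le> r"
  shows "support_fun K x \<le> r"
  unfolding support_fun_def using assms by (rule cSUP_least)

lemma support_fun_0: "K \<in> convex_bodies_o \<Longrightarrow> support_fun K 0 = 0"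
  by (auto simp: support_fun_def convex_bodies_o_def image_constant_conv)

lemma support_fun_nonneg: "K \<in> convex_bodies_o \<Longrightarrow> 0 \<le> support_fun K x"
  using inner_le_support_fun[of K 0 x] by (simp add: convex_bodies_o_def)

lemma support_fun_add_le:
  assumes "compact K" "K \<noteq> {}"
  shows "support_fun K (x + y) \<le> support_fun K x + support_fun K y"
proof (rule support_fun_le)
  fix z assume "z \<in> K"
  then show "(x + y) \<bullet> z \<le> support_fun K x + support_fun K y"
    using inner_le_support_fun[OF assms(1), of z x] inner_le_support_fun[OF assms(1), of z y]
    by (simp add: inner_add_left)
qed fact

lemma support_fun_scaleR:
  assumes "compact K" "K \<noteq> {}" "c > 0"
  shows "support_fun K (c *\<^sub>R x) = c * support_fun K x"
proof (rule antisym)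
  have le: "support_fun K (c *\<^sub>R x) \<le> c * support_fun K x" if "c > 0" for c x
    using inner_le_support_fun[OF assms(1)] that assms(2)
    by (intro support_fun_le) (auto intro: mult_left_mono)
  show "support_fun K (c *\<^sub>R x) \<le> c * support_fun K x" using \<open>c > 0\<close> by (rule le)
  show "c * support_fun K x \<le> support_fun K (c *\<^sub>R x)"
    using le[of "1 / c" "c *\<^sub>R x"] \<open>c > 0\<close> by (simp add: field_simps)
qed

text \<open>Compare a point of \<open>K\<close> with its nearest point in \<open>L\<close> by
  Cauchy-Schwarz. Used in both directions, the bound makes the support function at \<open>x\<close>
  Lipschitz in the body with constant \<open>norm x\<close>.\<close>

lemma support_fun_le_hausdorff_dist:
  assumes "compact K" "K \<noteq> {}" "compact L" "L \<noteq> {}"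
  shows "support_fun K x \<le> support_fun L x + norm x * hausdorff_dist K L"
proof (rule support_fun_le)
  fix y assume "y \<in> K"
  obtain z where z: "z \<in> L" "infdist y L = dist y z"
    using infdist_attains_inf[of L y] assms compact_imp_closed by metis
  have "x \<bullet> (y - z) \<le> norm x * norm (y - z)" by (rule norm_cauchy_schwarz)
  also have "\<dots> \<le> norm x * hausdorff_dist K L"
    using infdist_le_hausdorff_dist(1)[of K L y] assms \<open>y \<in> K\<close> z
    by (intro mult_left_mono) (auto simp: dist_norm)
  finally show "x \<bullet> y \<le> support_fun L x + norm x * hausdorff_dist K L"
    using inner_le_support_fun[OF \<open>compact L\<close> z(1), of x] by (simp add: inner_diff_right)
qed fact

lemma continuous_map_support_fun:
  "continuous_map hausdorff_topology euclideanreal (\<lambda>K. support_fun K x)"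
proof -
  have "\<exists>\<delta>>0. \<forall>L. L \<in> convex_bodies_o \<and> hausdorff_dist K L < \<delta> \<longrightarrow>
      dist (support_fun K x) (support_fun L x) < \<epsilon>"
    if K: "K \<in> convex_bodies_o" and \<epsilon>: "\<epsilon> > 0" for K :: "'a set" and \<epsilon> :: real
  proof (intro exI conjI allI impI)
    \<comment> \<open>The summand 1 keeps the denominator positive at \<open>x = 0\<close>.\<close>
    show "\<epsilon> / (norm x + 1) > 0" using \<epsilon> by (simp add: add_nonneg_pos)
    fix L :: "'a set" assume L: "L \<in> convex_bodies_o \<and> hausdorff_dist K L < \<epsilon> / (norm x + 1)"
    have "\<bar>support_fun K x - support_fun L x\<bar> \<le> norm x * hausdorff_dist K L"
    proof -
      have "compact K" "K \<noteq> {}" "compact L" "L \<noteq> {}" using K L by (auto simp: convex_bodies_o_def)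
      then show ?thesis
        using support_fun_le_hausdorff_dist[of K L x] support_fun_le_hausdorff_dist[of L K x]
        by (simp add: hausdorff_dist_commute[of L K] abs_le_iff)
    qed
    also have "\<dots> \<le> (norm x + 1) * hausdorff_dist K L"
      by (simp add: mult_right_mono hausdorff_dist_nonneg)
    also have "\<dots> < \<epsilon>"
      using L by (simp add: pos_less_divide_eq add_nonneg_pos mult.commute)
    finally show "dist (support_fun K x) (support_fun L x) < \<epsilon>" by (simp add: dist_real_def)
  qed
  then have "continuous_map hausdorff_topology (Metric_space.mtopology UNIV dist)
      (\<lambda>K. support_fun K x)"
    unfolding hausdorff_topology_def
    by (subst Metric_space.metric_continuous_map[OF Metric_space_hausdorff_dist])
      (auto simp: Met_TC.Metric_space_axioms)
  then show ?thesis by simp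
qed

section \<open>The class \<open>\<Phi>\<^sub>m\<close>\<close>

text \<open>\<open>Phi_class\<close> raises one coordinate at a time, so the coordinates of
  \<open>u\<close> are replaced by those of \<open>v\<close> one by one, by induction on the set of
  replaced indices.\<close>

lemma Phi_class_mono:
  fixes \<phi> :: "real ^ 'm \<Rightarrow> real"
  assumes \<phi>: "\<phi> \<in> Phi_class" and u: "u \<in> nonneg_orthant" and le: "\<And>j. u $ j \<le> v $ j"
  shows "\<phi> u \<le> \<phi> v"
proof -
  have nonneg: "0 \<le> u $ j" "0 \<le> v $ j" for j
    using u order_trans[OF _ le[of j], of 0] by (auto simp: nonneg_orthant_def)
  define w where "w A = (\<chi> i. if i \<in> A then v $ i else u $ i)" for A
  have "\<phi> u \<le> \<phi> (w A)" if "finite A" for A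
    using that
  proof induction
    case empty then show ?case by (simp add: w_def)
  next
    case (insert j A)
    have "w A \<in> nonneg_orthant"
      by (simp add: w_def nonneg_orthant_def nonneg)
    moreover have "w A $ j \<le> v $ j" using le by (simp add: w_def)
    ultimately have "\<phi> (w A) \<le> \<phi> (\<chi> i. if i = j then v $ j else w A $ i)"
      using \<phi> by (auto simp: Phi_class_def)
    also have "(\<chi> i. if i = j then v $ j else w A $ i) = w (insert j A)"
      by (auto simp: w_def vec_eq_iff)
    finally show ?case using insert.IH by simp
  qed
  from this[of UNIV] show ?thesis by (simp add: w_def)
qed

text \<open>Support functions are only subadditive, so the argument at \<open>x + y\<close> is
  dominated by a convex combination instead of being equal to one; monotonicity bridges this gap
  before convexity applies.\<close>

lemma Phi_class_convex_combination_le: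
  fixes \<phi> :: "real ^ 'm \<Rightarrow> real"
  assumes \<phi>: "\<phi> \<in> Phi_class" and uv: "u \<in> nonneg_orthant" "v \<in> nonneg_orthant"
    and w: "w \<in> nonneg_orthant" "\<And>j. w $ j \<le> a * u $ j + b * v $ j"
    and ab: "0 \<le> a" "0 \<le> b" "a + b = 1"
  shows "\<phi> w \<le> a * \<phi> u + b * \<phi> v"
proof -
  have "\<phi> w \<le> \<phi> (a *\<^sub>R u + b *\<^sub>R v)" using w by (intro Phi_class_mono[OF \<phi>]) auto
  also have "\<dots> \<le> a * \<phi> u + b * \<phi> v"
    using \<phi> uv ab by (simp add: Phi_class_def convex_on_def)
  finally show ?thesis .
qed

text \<open>Composing with the positive part turns \<open>\<phi>\<close> into a convex function on the whole space, which makes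
  continuity up to the boundary of the orthant automatic.\<close>

lemma Phi_class_continuous_on:
  fixes \<phi> :: "real ^ 'm \<Rightarrow> real"
  assumes \<phi>: "\<phi> \<in> Phi_class"
  shows "continuous_on nonneg_orthant \<phi>"
proof -
  let ?p = "\<lambda>v :: real ^ 'm. \<chi> j. max 0 (v $ j)"
  \<comment> \<open>The positive part is convex in each coordinate, and \<open>\<phi>\<close> is
    convex and increasing on the orthant.\<close>
  have "\<phi> (?p ((1 - t) *\<^sub>R u + t *\<^sub>R v)) \<le> (1 - t) * \<phi> (?p u) + t * \<phi> (?p v)"
    if "0 < t" "t < 1" for t u v
    using that
    by (intro Phi_class_convex_combination_le[OF \<phi>])
      (auto simp: nonneg_orthant_def intro!: add_nonneg_nonneg add_mono mult_left_mono)
  then have "convex_on UNIV (\<lambda>v. \<phi> (?p v))" by (intro convex_onI) auto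
  then have "continuous_on UNIV (\<lambda>v. \<phi> (?p v))" by (intro convex_on_continuous) auto
  then have "continuous_on nonneg_orthant (\<lambda>v. \<phi> (?p v))" by (rule continuous_on_subset) simp
  moreover have "?p v = v" if "v \<in> nonneg_orthant" for v
    using that by (simp add: vec_eq_iff nonneg_orthant_def)
  ultimately show ?thesis by (simp cong: continuous_on_cong)
qed

section \<open>The Orlicz integral\<close>

lemma continuous_map_vec_lambda:
  fixes f :: "'m::finite \<Rightarrow> 'b \<Rightarrow> 'c::topological_space"
  assumes "\<And>j. continuous_map X euclidean (f j)"
  shows "continuous_map X euclidean (\<lambda>x. \<chi> j. f j x)"
  using assms by (auto simp: continuous_map_atin intro!: tendsto_vec_lambda)

text \<open>Preimages of open sets are open in \<open>X\<close>, hence among the generators of the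
  sigma-algebra.\<close>

lemma borel_measurable_continuous_map:
  fixes f :: "'b \<Rightarrow> 'c::topological_space"
  assumes "continuous_map X euclidean f" "sets M = sets (borel_of_topology X)"
  shows "f \<in> borel_measurable M"
proof (rule borel_measurableI)
  fix U :: "'c set" assume "open U"
  then have "openin X {x \<in> topspace X. f x \<in> U}"
    using assms(1) by (simp add: openin_continuous_map_preimage)
  moreover have sub: "{U. openin X U} \<subseteq> Pow (topspace X)" by (auto dest: openin_subset)
  ultimately have "{x \<in> topspace X. f x \<in> U} \<in> sets M"
    unfolding assms(2) borel_of_topology_def by (simp add: sigma_sets.Basic)
  moreover have "space M = topspace X"
    using sets_eq_imp_space_eq[OF assms(2)] sub
    by (simp add: borel_of_topology_def)
  ultimately show "f -` U \<inter> space M \<in> sets M"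
    by (simp add: vimage_def Int_def conj_commute)
qed

lemma topspace_convex_bodies_tuple_topology:
  "topspace convex_bodies_tuple_topology = {K. \<forall>j. K j \<in> convex_bodies_o}"
  by (auto simp: convex_bodies_tuple_topology_def)

locale orlicz_measure =
  fixes \<phi> :: "real ^ 'm \<Rightarrow> real" and \<mu> :: "('m \<Rightarrow> 'a::euclidean_space set) measure"
  assumes \<phi>: "\<phi> \<in> Phi_class"
    and sets_\<mu>: "sets \<mu> = sets (borel_of_topology convex_bodies_tuple_topology)"
begin

lemma space_\<mu>: "K \<in> space \<mu> \<Longrightarrow> K j \<in> convex_bodies_o"
  using sets_eq_imp_space_eq[OF sets_\<mu>]
  by (simp add: borel_of_topology_def space_measure_of_conv topspace_convex_bodies_tuple_topology)

lemma orlicz_argument_nonneg: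
  "K \<in> space \<mu> \<Longrightarrow> 0 < s \<Longrightarrow> (\<chi> j. support_fun (K j) x / s) \<in> nonneg_orthant"
  by (simp add: nonneg_orthant_def space_\<mu> support_fun_nonneg)

lemma orlicz_integrand_nonneg:
  "K \<in> space \<mu> \<Longrightarrow> 0 < s \<Longrightarrow> 0 \<le> \<phi> (\<chi> j. support_fun (K j) x / s)"
  using orlicz_argument_nonneg \<phi> by (auto simp: Phi_class_def)

lemma borel_measurable_orlicz_integrand:
  assumes "s > 0"
  shows "(\<lambda>K. \<phi> (\<chi> j. support_fun (K j) x / s)) \<in> borel_measurable \<mu>"
proof (rule borel_measurable_continuous_map[OF _ sets_\<mu>])
  let ?X = "convex_bodies_tuple_topology :: ('m \<Rightarrow> 'a set) topology"
  have "continuous_map ?X euclideanreal (\<lambda>K. support_fun (K j) x)" for j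
    using continuous_map_compose[OF _ continuous_map_support_fun,
        of ?X "\<lambda>K. K j" x] continuous_map_product_projection[of j UNIV "\<lambda>_. hausdorff_topology"]
    by (simp add: convex_bodies_tuple_topology_def o_def)
  then have "continuous_map ?X euclidean (\<lambda>K. \<chi> j. support_fun (K j) x / s)"
    using assms by (intro continuous_map_vec_lambda continuous_map_real_divide) auto
  moreover have "(\<chi> j. support_fun (K j) x / s) \<in> nonneg_orthant" if "K \<in> topspace ?X" for K
    using that assms
    by (simp add: nonneg_orthant_def topspace_convex_bodies_tuple_topology support_fun_nonneg)
  \<comment> \<open>Continuity of \<open>\<phi>\<close> is known only relative to the orthant, so
    the codomain is restricted before composing.\<close>
  ultimately have "continuous_map ?X (top_of_set nonneg_orthant)
      (\<lambda>K. \<chi> j. support_fun (K j) x / s)"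
    by (auto simp: continuous_map_in_subtopology)
  moreover have "continuous_map (top_of_set nonneg_orthant) euclidean \<phi>"
    using Phi_class_continuous_on[OF \<phi>] by simp
  ultimately show "continuous_map ?X euclidean (\<lambda>K. \<phi> (\<chi> j. support_fun (K j) x / s))"
    by (rule continuous_map_compose[unfolded o_def])
qed

text \<open>The case \<open>y = 0\<close> gives the decay of the integral in \<open>s\<close>, the case \<open>w = s + t\<close> the subadditivity
  of the infimum.\<close>

lemma orlicz_integral_convex_combination_le:
  assumes st: "s > 0" "t > 0" "w > 0" and ab: "0 \<le> a" "0 \<le> b" "a + b = 1"
    and le: "\<And>K. K \<in> convex_bodies_o \<Longrightarrow>
      support_fun K z / w \<le> a * (support_fun K x / s) + b * (support_fun K y / t)"
  shows "orlicz_integral \<phi> \<mu> z w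
    \<le> ennreal a * orlicz_integral \<phi> \<mu> x s + ennreal b * orlicz_integral \<phi> \<mu> y t"
proof -
  let ?g = "\<lambda>x s K. \<phi> (\<chi> j. support_fun (K j) x / s)"
  note [measurable] = borel_measurable_orlicz_integrand[OF st(1)]
    borel_measurable_orlicz_integrand[OF st(2)]
  have "orlicz_integral \<phi> \<mu> z w
      \<le> (\<integral>\<^sup>+ K. ennreal a * ennreal (?g x s K) + ennreal b * ennreal (?g y t K) \<partial>\<mu>)"
    unfolding orlicz_integral_def
  proof (rule nn_integral_mono)
    fix K assume K: "K \<in> space \<mu>"
    have "?g z w K \<le> a * ?g x s K + b * ?g y t K"
      using le space_\<mu>[OF K]
      by (intro Phi_class_convex_combination_le[OF \<phi>] ab orlicz_argument_nonneg K st) auto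
    then have "ennreal (?g z w K) \<le> ennreal (a * ?g x s K + b * ?g y t K)"
      by (rule ennreal_leI)
    then show "ennreal (?g z w K) \<le> ennreal a * ennreal (?g x s K) + ennreal b * ennreal (?g y t K)"
      using ab orlicz_integrand_nonneg[OF K st(1)] orlicz_integrand_nonneg[OF K st(2)]
      by (simp add: ennreal_plus ennreal_mult)
  qed
  also have "\<dots> = ennreal a * orlicz_integral \<phi> \<mu> x s + ennreal b * orlicz_integral \<phi> \<mu> y t"
    by (simp add: orlicz_integral_def nn_integral_add nn_integral_cmult)
  finally show ?thesis .
qed

text \<open>By homogeneity of support functions the factor \<open>c\<close> cancels in every
  argument of \<open>\<phi>\<close>. Admissible values therefore scale with the point.\<close>

lemma orlicz_integral_scaleR:
  assumes "c > 0"
  shows "orlicz_integral \<phi> \<mu> (c *\<^sub>R x) (c * s) = orlicz_integral \<phi> \<mu> x s"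
  unfolding orlicz_integral_def
proof (rule nn_integral_cong)
  fix K assume K: "K \<in> space \<mu>"
  have "compact (K j)" "K j \<noteq> {}" for j
    using space_\<mu>[OF K, of j] by (auto simp: convex_bodies_o_def)
  then have "support_fun (K j) (c *\<^sub>R x) / (c * s) = support_fun (K j) x / s" for j
    using assms by (simp add: support_fun_scaleR)
  then show "ennreal (\<phi> (\<chi> j. support_fun (K j) (c *\<^sub>R x) / (c * s)))
      = ennreal (\<phi> (\<chi> j. support_fun (K j) x / s))" by simp
qed

lemma orlicz_integral_add_le_1:
  assumes "s > 0" "t > 0" "orlicz_integral \<phi> \<mu> x s \<le> 1" "orlicz_integral \<phi> \<mu> y t \<le> 1"
  shows "orlicz_integral \<phi> \<mu> (x + y) (s + t) \<le> 1"
proof -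
  \<comment> \<open>These weights satisfy \<open>a / s = b / t = 1 / (s + t)\<close>, which reduces
    the required domination to subadditivity of the support function.\<close>
  define a b where "a = s / (s + t)" and "b = t / (s + t)"
  have ab: "0 \<le> a" "0 \<le> b" "a + b = 1"
    using assms by (auto simp: a_def b_def add_divide_distrib[symmetric])
  have "orlicz_integral \<phi> \<mu> (x + y) (s + t)
      \<le> ennreal a * orlicz_integral \<phi> \<mu> x s + ennreal b * orlicz_integral \<phi> \<mu> y t"
  proof (rule orlicz_integral_convex_combination_le[OF assms(1,2) _ ab])
    fix K :: "'a set" assume "K \<in> convex_bodies_o"
    then have "support_fun K (x + y) / (s + t) \<le> (support_fun K x + support_fun K y) / (s + t)"
      using assms(1,2) by (intro divide_right_mono support_fun_add_le) (auto simp: convex_bodies_o_def)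
    then show "support_fun K (x + y) / (s + t) \<le> a * (support_fun K x / s) + b * (support_fun K y / t)"
      using assms(1,2) by (simp add: a_def b_def add_divide_distrib)
  qed (use assms in simp)
  also have "\<dots> \<le> ennreal a * 1 + ennreal b * 1"
    using assms by (intro add_mono mult_left_mono) auto
  also have "\<dots> = 1" using ab by (simp flip: ennreal_plus)
  finally show ?thesis .
qed

text \<open>Convexity and \<open>\<phi> 0 = 0\<close> give
  \<open>\<phi> (a v) \<le> a * \<phi> v\<close> for weights \<open>a\<close> in [0, 1], so dividing
  \<open>s\<close> by a small \<open>a\<close> brings a finite integral down to at most 1.\<close>

lemma ex_orlicz_integral_le_1:
  assumes "s > 0" "orlicz_integral \<phi> \<mu> x s < \<infinity>"
  shows "\<exists>t>0. orlicz_integral \<phi> \<mu> x t \<le> 1"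
proof -
  obtain r where r: "orlicz_integral \<phi> \<mu> x s = ennreal r" "r \<ge> 0"
    using assms(2) by (cases "orlicz_integral \<phi> \<mu> x s") auto
  \<comment> \<open>Using \<open>r + 1\<close> instead of \<open>r\<close> ensures
    \<open>a \<le> 1\<close> and covers \<open>r = 0\<close>.\<close>
  define a where "a = 1 / (r + 1)"
  have a: "0 < a" "a \<le> 1" "a * r \<le> 1" using r(2) by (auto simp: a_def field_simps)
  have "orlicz_integral \<phi> \<mu> x (s / a)
      \<le> ennreal a * orlicz_integral \<phi> \<mu> x s + ennreal (1 - a) * orlicz_integral \<phi> \<mu> 0 1"
    using a assms(1)
    by (intro orlicz_integral_convex_combination_le) (auto simp: support_fun_0 mult.commute)
  \<comment> \<open>The integrand vanishes identically, so this holds even if \<open>\<mu>\<close>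
    is infinite.\<close>
  also have "orlicz_integral \<phi> \<mu> 0 1 = 0"
  proof -
    have "(\<chi> j. support_fun (K j) 0 / 1) = (0 :: real ^ 'm)" if "K \<in> space \<mu>" for K
      using space_\<mu>[OF that] by (simp add: vec_eq_iff support_fun_0)
    then show ?thesis
      using \<phi> by (simp add: orlicz_integral_def Phi_class_def cong: nn_integral_cong)
  qed
  also have "ennreal a * orlicz_integral \<phi> \<mu> x s + ennreal (1 - a) * 0 \<le> 1"
    using a r by (simp flip: ennreal_mult)
  finally show ?thesis using a(1) assms(1) by (intro exI[of _ "s / a"]) simp
qed

end

theorem lemma4p2:
  fixes \<phi> :: "real ^ 'm \<Rightarrow> real"
    and \<mu> :: "('m \<Rightarrow> (real ^ 'n) set) measure"
  assumes "CARD('n) \<ge> 2"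
    and "\<phi> \<in> Phi_class"
    and "sets \<mu> = sets (borel_of_topology convex_bodies_tuple_topology)"
    and "\<And>x :: real ^ 'n. \<exists>s>0. orlicz_integral \<phi> \<mu> x s < \<infinity>"
  shows "\<exists>C :: (real ^ 'n) set. compact C \<and> convex C \<and> C \<noteq> {} \<and>
    (\<forall>x. support_fun C x = Inf {s. s > 0 \<and> orlicz_integral \<phi> \<mu> x s \<le> 1})"
proof -
  interpret orlicz_measure \<phi> \<mu> using assms by unfold_locales
  define S where "S x = {s. s > 0 \<and> orlicz_integral \<phi> \<mu> x s \<le> 1}" for x
  \<comment> \<open>Here the finiteness of the integral enters: it makes the infimum one over a
    nonempty set, so that \<open>Inf\<close> has its intended real value.\<close>
  have ne: "S x \<noteq> {}" for x
    using assms(4)[of x] ex_orlicz_integral_le_1 by (auto simp: S_def)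
  have nonneg: "0 \<le> s" if "s \<in> S x" for s x using that by (simp add: S_def)
  have "Inf (S (c *\<^sub>R x)) = c * Inf (S x)" if "c > 0" for c x
    using that by (intro Inf_scaleR_eq ne nonneg) (auto simp: S_def orlicz_integral_scaleR)
  moreover have "Inf (S (x + y)) \<le> Inf (S x) + Inf (S y)" for x y
    by (intro Inf_add_le ne nonneg) (auto simp: S_def orlicz_integral_add_le_1)
  ultimately obtain C where "compact C" "convex C" "C \<noteq> {}" "\<And>x. support_fun C x = Inf (S x)"
    using sublinear_eq_support_fun[of "\<lambda>x. Inf (S x)"] by blast
  then show ?thesis unfolding S_def by blast
qed

end
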